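(* The Dual-minus order $\overset{\rm D}{\leq}$ is a partial order (reflexive, antisymmetric and transitive) on the set of all dual matrices in $\mathbb{D}^{m\times n}$ whose dual Moore-Penrose generalized inverse (DMPGI) exists.
   Context: $\varepsilon$ is the dual unit: $\varepsilon\neq 0$, $\varepsilon^2=0$, commuting with reals. $\mathbb{D}^{m\times n}$ is the set of $m\times n$ dual matrices $\widehat E=E+\varepsilon E_0$ with $E,E_0\in\mathbb{R}^{m\times n}$, with the obvious addition, multiplication and transpose $\widehat E^{T}=E^T+\varepsilon E_0^T$. The DMPGI of $\widehat E\in\mathbb{D}^{m\times n}$ is the unique $\widehat X\in\mathbb{D}^{n\times m}$, if it exists, with $\widehat E\widehat X\widehat E=\widehat E$, $\widehat X\widehat E\widehat X=\widehat X$, $(\widehat E\widehat X)^T=\widehat E\widehat X$, $(\widehat X\widehat E)^T=\widehat X\widehat E$. Minus partial order on real matrices of the same size: $E\leq F$ means $\mathrm{rk}(F-E)=\mathrm{rk}(F)-\mathrm{rk}(E)$. Dual-minus order: for $\widehat E=E+\varepsilon E_0,\widehat F=F+\varepsilon F_0\in\mathbb{D}^{m\times n}$ whose DMPGIs exist, $\widehat E\overset{\rm D}{\leq}\widehat F$ means that $E\leq F$ and the DMPGI of $\widehat F-\widehat E$ exists. *)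

theory Defs
  imports "HOL-Analysis.Analysis"
begin

text \<open>
  The ring of dual numbers \<open>a + \<epsilon>b\<close> with real \<open>a\<close>, \<open>b\<close> and \<open>\<epsilon>\<^sup>2 = 0\<close>.  Dual matrices are
  ordinary matrices \<open>dual ^ 'n ^ 'm\<close> over this ring, so that their addition, multiplication and
  transpose are those of the library.
\<close>

datatype dual = Dual (std_part: real) (inf_part: real)

lemma dual_eq_iff: "x = y \<longleftrightarrow> std_part x = std_part y \<and> inf_part x = inf_part y"
  by (auto intro: dual.expand)

instantiation dual :: comm_ring_1
begin

definition "0 = Dual 0 0"
definition "1 = Dual 1 0"
definition "x + y = Dual (std_part x + std_part y) (inf_part x + inf_part y)"
definition "- x = Dual (- std_part x) (- inf_part x)"
definition "x - y = Dual (std_part x - std_part y) (inf_part x - inf_part y)"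
definition "x * y = Dual (std_part x * std_part y) (std_part x * inf_part y + inf_part x * std_part y)"

instance
  by standard
    (simp_all add: zero_dual_def one_dual_def plus_dual_def uminus_dual_def minus_dual_def
      times_dual_def algebra_simps)

end

instantiation dual :: real_algebra_1
begin

definition "scaleR r x = Dual (r * std_part x) (r * inf_part x)"

instance
  by standard
    (simp_all add: scaleR_dual_def one_dual_def plus_dual_def times_dual_def algebra_simps)

end

lemma dual_sel [simp]:
  "std_part 0 = 0" "inf_part 0 = 0" "std_part 1 = 1" "inf_part 1 = 0"
  "std_part (x + y) = std_part x + std_part y" "inf_part (x + y) = inf_part x + inf_part y"
  "std_part (- x) = - std_part x" "inf_part (- x) = - inf_part x"
  "std_part (x - y) = std_part x - std_part y" "inf_part (x - y) = inf_part x - inf_part y"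
  "std_part (x * y) = std_part x * std_part y" "inf_part (x * y) = std_part x * inf_part y + inf_part x * std_part y"
  "std_part (r *\<^sub>R x) = r * std_part x" "inf_part (r *\<^sub>R x) = r * inf_part x"
  "std_part (of_real r) = r" "inf_part (of_real r) = 0"
  by (simp_all add: zero_dual_def one_dual_def plus_dual_def uminus_dual_def minus_dual_def
      times_dual_def scaleR_dual_def of_real_def)

definition dual_unit :: dual ("\<epsilon>")
  where "\<epsilon> = Dual 0 1"

lemma dual_unit_nonzero: "\<epsilon> \<noteq> 0"
  and dual_unit_square: "\<epsilon>\<^sup>2 = 0"
  and dual_decomposition: "x = of_real (std_part x) + \<epsilon> * of_real (inf_part x)"
  by (simp_all add: dual_eq_iff dual_unit_def power2_eq_square)

definition std_matrix :: "dual ^ 'n ^ 'm \<Rightarrow> real ^ 'n ^ 'm"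
  where "std_matrix A = (\<chi> i j. std_part (A $ i $ j))"

definition inf_matrix :: "dual ^ 'n ^ 'm \<Rightarrow> real ^ 'n ^ 'm"
  where "inf_matrix A = (\<chi> i j. inf_part (A $ i $ j))"

definition dual_matrix :: "real ^ 'n ^ 'm \<Rightarrow> real ^ 'n ^ 'm \<Rightarrow> dual ^ 'n ^ 'm"
  where "dual_matrix E E0 = (\<chi> i j. of_real (E $ i $ j) + \<epsilon> * of_real (E0 $ i $ j))"

lemma dual_matrix_unique_decomposition:
  "A = dual_matrix E E0 \<longleftrightarrow> E = std_matrix A \<and> E0 = inf_matrix A"
  by (auto simp: vec_eq_iff dual_matrix_def std_matrix_def inf_matrix_def dual_eq_iff dual_unit_def)

lemma std_sum: "std_part (sum f S) = (\<Sum>x\<in>S. std_part (f x))"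
  and inf_sum: "inf_part (sum f S) = (\<Sum>x\<in>S. inf_part (f x))"
  by (induction S rule: infinite_finite_induct) simp_all

lemma dual_matrix_add:
  "dual_matrix E E0 + dual_matrix F F0 = dual_matrix (E + F) (E0 + F0)"
  by (simp add: vec_eq_iff dual_matrix_def dual_eq_iff dual_unit_def)

lemma dual_matrix_diff:
  "dual_matrix E E0 - dual_matrix F F0 = dual_matrix (E - F) (E0 - F0)"
  by (simp add: vec_eq_iff dual_matrix_def dual_eq_iff dual_unit_def)

lemma dual_matrix_mult:
  "dual_matrix E E0 ** dual_matrix F F0 = dual_matrix (E ** F) (E ** F0 + E0 ** F)"
  by (simp add: vec_eq_iff dual_matrix_def matrix_matrix_mult_def dual_eq_iff dual_unit_def
      std_sum inf_sum sum.distrib)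

lemma dual_matrix_transpose:
  "transpose (dual_matrix E E0) = dual_matrix (transpose E) (transpose E0)"
  by (simp add: vec_eq_iff dual_matrix_def transpose_def)

definition is_DMPGI :: "dual ^ 'n ^ 'm \<Rightarrow> dual ^ 'm ^ 'n \<Rightarrow> bool"
  where "is_DMPGI E X \<longleftrightarrow>
    E ** X ** E = E \<and> X ** E ** X = X \<and>
    transpose (E ** X) = E ** X \<and> transpose (X ** E) = X ** E"

lemma is_DMPGI_unique:
  assumes "is_DMPGI E X" and "is_DMPGI E Y"
  shows "X = Y"
proof -
  have X: "E ** X ** E = E" "X ** E ** X = X" "transpose (E ** X) = E ** X" "transpose (X ** E) = X ** E"
    and Y: "E ** Y ** E = E" "Y ** E ** Y = Y" "transpose (E ** Y) = E ** Y" "transpose (Y ** E) = Y ** E"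
    using assms by (simp_all add: is_DMPGI_def)
  have "E ** X = transpose (E ** Y ** E ** X)"
    using X(3) Y(1) by simp
  also have "\<dots> = transpose (E ** X) ** transpose (E ** Y)"
    by (metis matrix_mul_assoc matrix_transpose_mul)
  also have "\<dots> = E ** Y"
    by (metis X(1,3) Y(3) matrix_mul_assoc)
  finally have 1: "E ** X = E ** Y" .
  have "X ** E = transpose (X ** (E ** Y ** E))"
    using X(4) Y(1) by simp
  also have "\<dots> = transpose (Y ** E) ** transpose (X ** E)"
    by (metis matrix_mul_assoc matrix_transpose_mul)
  also have "\<dots> = Y ** E"
    by (metis X(1,4) Y(4) matrix_mul_assoc)
  finally have 2: "X ** E = Y ** E" .
  show ?thesis
    by (metis 1 2 X(2) Y(2) matrix_mul_assoc)
qed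

definition has_DMPGI :: "dual ^ 'n ^ 'm \<Rightarrow> bool"
  where "has_DMPGI E \<longleftrightarrow> (\<exists>X. is_DMPGI E X)"

text \<open>The ranks are subtracted as integers, since subtraction on \<open>nat\<close> truncates.\<close>

definition minus_le :: "real ^ 'n ^ 'm \<Rightarrow> real ^ 'n ^ 'm \<Rightarrow> bool"
  where "minus_le E F \<longleftrightarrow> int (rank (F - E)) = int (rank F) - int (rank E)"

definition DMPGI_matrices :: "(dual ^ 'n ^ 'm) set"
  where "DMPGI_matrices = {E. has_DMPGI E}"

definition dual_minus_le :: "dual ^ 'n ^ 'm \<Rightarrow> dual ^ 'n ^ 'm \<Rightarrow> bool"
  where "dual_minus_le E F \<longleftrightarrow>
    E \<in> DMPGI_matrices \<and> F \<in> DMPGI_matrices \<and>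
    minus_le (std_matrix E) (std_matrix F) \<and> has_DMPGI (F - E)"

end

theory Submission imports Defs begin

text \<open>
  The proof rests on a rank-free criterion: \<open>E + \<epsilon>E\<^sub>0\<close> has a DMPGI iff \<open>E\<^sub>0\<close> maps the kernel of
  \<open>E\<close> into the range of \<open>E\<close>.  In a chain \<open>E \<le> F \<le> G\<close> the ranks of the standard parts of
  \<open>B = F - E\<close> and \<open>C = G - F\<close> add up to that of \<open>B + C\<close>, so that the kernel of \<open>B + C\<close> is the
  intersection of the kernels and its range is the sum of the ranges; hence the criterion passes
  from \<open>B\<close> and \<open>C\<close> to \<open>B + C\<close>.  For antisymmetry, the criterion says that a purely infinitesimal
  matrix has a DMPGI only if it is zero.
\<close>

section \<open>Standard and infinitesimal parts of dual matrices\<close>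

lemma dual_matrix_eq_iff:
  "A = B \<longleftrightarrow> std_matrix A = std_matrix B \<and> inf_matrix A = inf_matrix B"
  using dual_matrix_unique_decomposition by metis

lemma std_dual_matrix [simp]: "std_matrix (dual_matrix E E0) = E"
  and inf_dual_matrix [simp]: "inf_matrix (dual_matrix E E0) = E0"
  using dual_matrix_unique_decomposition by metis+

lemma std_matrix_simps [simp]:
  "std_matrix 0 = 0"
  "std_matrix (A + B) = std_matrix A + std_matrix B"
  "std_matrix (A - B) = std_matrix A - std_matrix B"
  "std_matrix (transpose A) = transpose (std_matrix A)"
  by (simp_all add: vec_eq_iff std_matrix_def transpose_def)

lemma inf_matrix_simps [simp]:
  "inf_matrix 0 = 0"
  "inf_matrix (A + B) = inf_matrix A + inf_matrix B"
  "inf_matrix (A - B) = inf_matrix A - inf_matrix B"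
  "inf_matrix (transpose A) = transpose (inf_matrix A)"
  by (simp_all add: vec_eq_iff inf_matrix_def transpose_def)

lemma std_matrix_mult [simp]: "std_matrix (A ** B) = std_matrix A ** std_matrix B"
  and inf_matrix_mult [simp]:
    "inf_matrix (A ** B) = std_matrix A ** inf_matrix B + inf_matrix A ** std_matrix B"
  using dual_matrix_mult[of "std_matrix A" "inf_matrix A" "std_matrix B" "inf_matrix B"]
  by (metis dual_matrix_unique_decomposition)+

section \<open>Matrix algebra and real inner inverses\<close>

lemma matrix_diff_ldistrib: "A ** (B - C) = A ** B - A ** (C :: 'a::comm_ring_1 ^ 'n ^ 'm)"
  by (simp add: vec_eq_iff matrix_matrix_mult_def right_diff_distrib sum_subtractf)

lemma matrix_vector_mult_minus_right: "A *v (- x) = - (A *v x)" for A :: "real ^ 'n ^ 'm"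
  by (rule linear_neg[OF matrix_vector_mul_linear])

text \<open>A linear map has a linear right inverse on its range; the matrix of that right inverse
  serves as \<open>X\<close>.\<close>

lemma real_inner_inverse_exists:
  fixes A :: "real ^ 'n ^ 'm"
  obtains X where "A ** X ** A = A"
proof -
  obtain g where g: "linear g" "\<forall>v \<in> range ((*v) A). A *v g v = v"
    using real_vector.linear_exists_right_inverse_on[of "(*v) A" UNIV]
      matrix_vector_mul_linear[of A] real_vector.subspace_UNIV
    unfolding linear_def by blast
  have "A *v (matrix g *v (A *v x)) = A *v x" for x
    using g by (simp add: matrix_works)
  then have "A ** matrix g ** A = A"
    by (simp add: matrix_eq flip: matrix_vector_mul_assoc)
  then show thesis ..
qed

lemma real_transpose_mult_cancel:
  fixes A :: "real ^ 'n ^ 'm"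
  assumes "transpose A *v (A *v x) = 0"
  shows "A *v x = 0"
proof -
  have "(A *v x) \<bullet> (A *v x) = x \<bullet> (transpose A *v (A *v x))"
    by (metis dot_lmul_matrix inner_commute transpose_matrix_vector)
  then show ?thesis
    using assms by simp
qed

section \<open>Inner inverses of dual matrices\<close>

definition std_kernel_condition :: "dual ^ 'n ^ 'm \<Rightarrow> bool"
  where "std_kernel_condition E \<longleftrightarrow>
    (\<forall>x. std_matrix E *v x = 0 \<longrightarrow> inf_matrix E *v x \<in> range ((*v) (std_matrix E)))"

text \<open>In the infinitesimal part of \<open>E ** K ** E\<close>, every term except S X N ends in
  S and so vanishes on the kernel of S.\<close>

lemma inner_inverse_imp_kernel_condition:
  assumes "E ** K ** E = E"
  shows "std_kernel_condition E"
  unfolding std_kernel_condition_def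
proof (intro allI impI)
  fix x
  assume x: "std_matrix E *v x = 0"
  let ?S = "std_matrix E" and ?N = "inf_matrix E" and ?X = "std_matrix K"
  have "?N *v x = inf_matrix (E ** K ** E) *v x"
    using assms by simp
  also have "\<dots> = ?S *v (?X *v (?N *v x))"
    using x by (simp add: matrix_vector_mult_add_rdistrib flip: matrix_vector_mul_assoc)
  finally show "?N *v x \<in> range ((*v) ?S)"
    by blast
qed

lemma kernel_condition_imp_inner_inverse:
  assumes "std_kernel_condition E"
  obtains K where "E ** K ** E = E"
proof -
  let ?S = "std_matrix E" and ?N = "inf_matrix E"
  obtain X where X: "?S ** X ** ?S = ?S"
    using real_inner_inverse_exists .
  then have SXS: "?S *v (X *v (?S *v v)) = ?S *v v" for v
    by (metis matrix_vector_mul_assoc)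
  txt \<open>The infinitesimal part of \<open>E K E = E\<close> amounts, for this \<open>K\<close>, to \<open>(I - S X) N (I - X S) = 0\<close>.\<close>
  define K where "K = dual_matrix X (0 - X ** ?N ** X)"
  have K_inf: "inf_matrix K *v w = - (X *v (?N *v (X *v w)))" for w
    using matrix_vector_mult_diff_rdistrib[of 0 "X ** ?N ** X" w]
    by (simp add: K_def flip: matrix_vector_mul_assoc)
  have K_std: "std_matrix K = X"
    by (simp add: K_def)
  have "inf_matrix (E ** K ** E) *v v = ?N *v v" for v
  proof -
    let ?x = "v - X *v (?S *v v)"
    have "?S *v ?x = 0"
      by (simp add: matrix_vector_mult_diff_distrib SXS)
    then obtain y where "?N *v ?x = ?S *v y"
      using assms unfolding std_kernel_condition_def by blast
    \<comment> \<open>S X fixes every vector in the range of S.\<close>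
    then have "?S *v (X *v (?N *v ?x)) = ?N *v ?x"
      by (simp add: SXS)
    then show ?thesis
      by (simp add: K_std K_inf matrix_vector_mult_minus_right algebra_simps
          flip: matrix_vector_mul_assoc)
  qed
  then have "E ** K ** E = E"
    by (simp add: dual_matrix_eq_iff matrix_eq) (simp add: K_std X flip: matrix_eq)
  then show thesis ..
qed

text \<open>
  Without an inner inverse this fails: for the \<open>1 \<times> 1\<close> matrix \<open>E = \<epsilon>\<close>, one has
  \<open>transpose E ** E = 0\<close>.
\<close>

lemma dual_transpose_mult_cancel:
  fixes E :: "dual ^ 'n ^ 'm" and W :: "dual ^ 'k ^ 'n"
  assumes K: "E ** K ** E = E" and W: "transpose E ** (E ** W) = 0"
  shows "E ** W = 0"
proof -
  let ?S = "std_matrix E" and ?N = "inf_matrix E"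
    and ?V = "std_matrix W" and ?U = "inf_matrix W" and ?X = "std_matrix K"
  have std: "?S *v (?V *v x) = 0" for x
  proof (rule real_transpose_mult_cancel)
    have "std_matrix (transpose E ** (E ** W)) *v x = 0"
      using W by simp
    then show "transpose ?S *v (?S *v (?V *v x)) = 0"
      by (simp flip: matrix_vector_mul_assoc)
  qed
  have NV: "?N *v (?V *v x) = ?S *v (?X *v (?N *v (?V *v x)))" for x
  proof -
    have "?N *v (?V *v x) = inf_matrix (E ** K ** E) *v (?V *v x)"
      using K by simp
    then show ?thesis
      using std by (simp add: matrix_vector_mult_add_rdistrib flip: matrix_vector_mul_assoc)
  qed
  have "?S *v (?U *v x) + ?N *v (?V *v x) = 0" for x
  proof -
    \<comment> \<open>By \<open>NV\<close> the term N V x lies in the range of S. Thus the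
      infinitesimal part of \<open>E ** W\<close> at \<open>x\<close> is S applied to
      \<open>?u\<close>, and the real cancellation law applies to it.\<close>
    let ?u = "?U *v x + ?X *v (?N *v (?V *v x))"
    have *: "?S *v ?u = ?S *v (?U *v x) + ?N *v (?V *v x)"
      by (simp add: matrix_vector_right_distrib flip: NV)
    have "inf_matrix (transpose E ** (E ** W)) *v x = 0"
      using W by simp
    then have "transpose ?S *v (?S *v ?u) = 0"
      unfolding * using std
      by (simp add: algebra_simps flip: matrix_vector_mul_assoc)
    then have "?S *v ?u = 0"
      by (rule real_transpose_mult_cancel)
    then show ?thesis
      by (simp add: *)
  qed
  with std show ?thesis
    by (simp add: dual_matrix_eq_iff matrix_eq algebra_simps flip: matrix_vector_mul_assoc)
qed

section \<open>From an inner inverse to the DMPGI\<close>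

text \<open>As for the normal equations of least squares, \<open>transpose E ** E\<close> is
  inverted: its standard part has the same kernel as that of \<open>E\<close>, so it inherits the
  kernel criterion and has an inner inverse \<open>G\<close>.\<close>

lemma dual_least_squares_inverse_exists:
  fixes E :: "dual ^ 'n ^ 'm"
  assumes K: "E ** K ** E = E"
  obtains Y where "E ** Y ** E = E" "transpose (E ** Y) = E ** Y"
proof -
  let ?S = "std_matrix E" and ?N = "inf_matrix E"
  have "std_kernel_condition (transpose E ** E)"
    unfolding std_kernel_condition_def
  proof (intro allI impI)
    fix x
    assume "std_matrix (transpose E ** E) *v x = 0"
    then have "transpose ?S *v (?S *v x) = 0"
      by (simp add: matrix_vector_mul_assoc)
    then have x: "?S *v x = 0"
      by (rule real_transpose_mult_cancel)
    then obtain y where "?N *v x = ?S *v y"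
      using inner_inverse_imp_kernel_condition[OF K] unfolding std_kernel_condition_def by blast
    then have "inf_matrix (transpose E ** E) *v x = std_matrix (transpose E ** E) *v y"
      using x by (simp add: algebra_simps flip: matrix_vector_mul_assoc)
    then show "inf_matrix (transpose E ** E) *v x \<in> range ((*v) (std_matrix (transpose E ** E)))"
      by blast
  qed
  then obtain G where G: "transpose E ** E ** G ** (transpose E ** E) = transpose E ** E"
    using kernel_condition_imp_inner_inverse by blast
  define Y where "Y = G ** transpose E"
  have "E ** (Y ** E - mat 1) = 0"
    using G by - (rule dual_transpose_mult_cancel[OF K],
      simp add: Y_def matrix_diff_ldistrib matrix_mul_assoc)
  then have EYE: "E ** Y ** E = E"
    by (simp add: matrix_diff_ldistrib matrix_mul_assoc)
  \<comment> \<open>The left side is \<open>E ** transpose G ** transpose E\<close>; it begins with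
    \<open>E\<close>, which \<open>E ** Y\<close> fixes. The right side is symmetric.\<close>
  have "transpose (E ** Y) = E ** Y ** transpose (E ** Y)"
    by (metis EYE Y_def matrix_mul_assoc matrix_transpose_mul transpose_transpose)
  then have "transpose (E ** Y) = E ** Y"
    by (metis matrix_transpose_mul transpose_transpose)
  with EYE show thesis ..
qed

lemma has_DMPGI_iff_inner_inverse: "has_DMPGI E \<longleftrightarrow> (\<exists>K. E ** K ** E = E)"
proof
  assume "has_DMPGI E"
  then show "\<exists>K. E ** K ** E = E"
    unfolding has_DMPGI_def is_DMPGI_def by blast
next
  assume "\<exists>K. E ** K ** E = E"
  then obtain K where K: "E ** K ** E = E" ..
  obtain Y where Y: "E ** Y ** E = E" "transpose (E ** Y) = E ** Y"
    using dual_least_squares_inverse_exists[OF K] .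
  \<comment> \<open>Transposition exchanges the two symmetry conditions, so a least-squares inverse
    of \<open>transpose E\<close> supplies the second one.\<close>
  have "transpose E ** transpose K ** transpose E = transpose E"
    by (metis K matrix_mul_assoc matrix_transpose_mul)
  then obtain Z' where Z': "transpose E ** Z' ** transpose E = transpose E"
      "transpose (transpose E ** Z') = transpose E ** Z'"
    by (rule dual_least_squares_inverse_exists)
  txt \<open>\<open>Y\<close> and \<open>Z\<close> are a \<open>{1,3}\<close>- and a \<open>{1,4}\<close>-inverse of \<open>E\<close>; Urquhart's formula gives \<open>Z E Y\<close>.\<close>
  define Z where "Z = transpose Z'"
  have Z: "E ** Z ** E = E" "transpose (Z ** E) = Z ** E"
    using Z' unfolding Z_def
    by (metis matrix_mul_assoc matrix_transpose_mul transpose_transpose)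
      (metis Z'(2) matrix_transpose_mul transpose_transpose)
  have "E ** (Z ** E ** Y) = E ** Y" and "Z ** E ** Y ** E = Z ** E"
    using Y(1) Z(1) by (metis matrix_mul_assoc)+
  then have "is_DMPGI E (Z ** E ** Y)"
    unfolding is_DMPGI_def using Y Z by (metis matrix_mul_assoc)
  then show "has_DMPGI E"
    unfolding has_DMPGI_def ..
qed

lemma has_DMPGI_iff_kernel_condition: "has_DMPGI E \<longleftrightarrow> std_kernel_condition E"
  by (metis has_DMPGI_iff_inner_inverse inner_inverse_imp_kernel_condition
      kernel_condition_imp_inner_inverse)

section \<open>Rank additivity, kernels and ranges\<close>

lemma range_matrix_add_subset:
  "range ((*v) (A + B)) \<subseteq> {x + y |x y. x \<in> range ((*v) A) \<and> y \<in> range ((*v) B)}"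
  by (auto simp: matrix_vector_mult_add_rdistrib)

lemma subspace_range_matrix: "subspace (range ((*v) (A :: real ^ 'n ^ 'm)))"
  by (simp add: linear_subspace_image)

lemma rank_add_le:
  fixes A B :: "real ^ 'n ^ 'm"
  shows "rank (A + B) \<le> rank A + rank B"
proof -
  let ?T = "{x + y |x y. x \<in> range ((*v) A) \<and> y \<in> range ((*v) B)}"
  have "rank (A + B) \<le> dim ?T"
    unfolding rank_dim_range by (rule dim_subset[OF range_matrix_add_subset])
  also have "\<dots> \<le> rank A + rank B"
    using dim_sums_Int[OF subspace_range_matrix[of A] subspace_range_matrix[of B]]
    by (simp add: rank_dim_range)
  finally show ?thesis .
qed

text \<open>The dimension of the sum of the two ranges lies between \<open>rank (A + B)\<close> and
  \<open>rank A + rank B\<close>. Equality on the left makes the ranges agree; equality on the right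
  makes the two ranges meet only in 0.\<close>

lemma rank_add_eq_imp_range_kernel:
  fixes A B :: "real ^ 'n ^ 'm"
  assumes "rank (A + B) = rank A + rank B"
  shows "range ((*v) (A + B)) = {x + y |x y. x \<in> range ((*v) A) \<and> y \<in> range ((*v) B)}"
    and "(A + B) *v x = 0 \<Longrightarrow> A *v x = 0 \<and> B *v x = 0"
proof -
  let ?R = "range ((*v) A)" and ?S = "range ((*v) B)" and ?U = "range ((*v) (A + B))"
  let ?T = "{x + y |x y. x \<in> ?R \<and> y \<in> ?S}"
  have le: "dim ?U \<le> dim ?T"
    by (rule dim_subset[OF range_matrix_add_subset])
  have sum: "dim ?T + dim (?R \<inter> ?S) = dim ?U"
    using dim_sums_Int[OF subspace_range_matrix[of A] subspace_range_matrix[of B]] assms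
    by (simp add: rank_dim_range)
  show "?U = ?T"
    using sum by (intro subspace_dim_equal range_matrix_add_subset subspace_range_matrix
        subspace_sums) auto
  have "dim (?R \<inter> ?S) = 0"
    using le sum by linarith
  then have int: "?R \<inter> ?S \<subseteq> {0}"
    by simp
  assume "(A + B) *v x = 0"
  then have eq: "A *v x = B *v (- x)"
    by (simp add: matrix_vector_mult_add_rdistrib matrix_vector_mult_minus_right eq_neg_iff_add_eq_0)
  then have "A *v x \<in> ?R \<inter> ?S"
    by blast
  with int have "A *v x = 0"
    by blast
  with \<open>(A + B) *v x = 0\<close> show "A *v x = 0 \<and> B *v x = 0"
    by (simp add: matrix_vector_mult_add_rdistrib)
qed

lemma has_DMPGI_add:
  assumes "has_DMPGI A" "has_DMPGI B"
    and rank: "rank (std_matrix A + std_matrix B) = rank (std_matrix A) + rank (std_matrix B)"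
  shows "has_DMPGI (A + B)"
  unfolding has_DMPGI_iff_kernel_condition std_kernel_condition_def
proof (intro allI impI)
  fix x
  assume "std_matrix (A + B) *v x = 0"
  then have "std_matrix A *v x = 0" "std_matrix B *v x = 0"
    using rank_add_eq_imp_range_kernel(2)[OF rank] by auto
  then have "inf_matrix A *v x \<in> range ((*v) (std_matrix A))"
    and "inf_matrix B *v x \<in> range ((*v) (std_matrix B))"
    using assms unfolding has_DMPGI_iff_kernel_condition std_kernel_condition_def by blast+
  then show "inf_matrix (A + B) *v x \<in> range ((*v) (std_matrix (A + B)))"
    using rank_add_eq_imp_range_kernel(1)[OF rank] by (auto simp: matrix_vector_mult_add_rdistrib)
qed

section \<open>The minus order and the dual-minus order\<close>

lemma minus_le_iff: "minus_le E F \<longleftrightarrow> rank F = rank E + rank (F - E)"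
  unfolding minus_le_def by linarith

lemma rank_eq_0_iff: "rank A = 0 \<longleftrightarrow> A = (0 :: real ^ 'n ^ 'm)"
  by (auto simp: rank_dim_range matrix_eq)

lemma minus_le_antisym:
  assumes "minus_le E F" "minus_le F E"
  shows "E = F"
proof -
  have "rank (F - E) = 0"
    using assms unfolding minus_le_iff by linarith
  then show ?thesis
    by (simp add: rank_eq_0_iff)
qed

text \<open>Subadditivity of rank gives rank G \<le> rank E + rank (G - E) \<le> rank E + rank (F -
  E) + rank (G - F), and the last sum is rank G by hypothesis, so equality holds throughout.\<close>

lemma minus_le_trans_rank:
  assumes "minus_le E F" "minus_le F G"
  shows "minus_le E G" and "rank (G - E) = rank (F - E) + rank (G - F)"
proof -
  have "rank G \<le> rank E + rank (G - E)"
    using rank_add_le[of E "G - E"] by simp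
  moreover have "rank (G - E) \<le> rank (F - E) + rank (G - F)"
    using rank_add_le[of "F - E" "G - F"] by simp
  ultimately show "minus_le E G" and "rank (G - E) = rank (F - E) + rank (G - F)"
    using assms unfolding minus_le_iff by linarith+
qed

text \<open>The zero matrix has full kernel and range {0}, so the kernel criterion forces the
  infinitesimal part to vanish.\<close>

lemma has_DMPGI_std_0_iff:
  assumes "std_matrix A = 0"
  shows "has_DMPGI A \<longleftrightarrow> A = 0"
  using assms by (auto simp: has_DMPGI_iff_kernel_condition std_kernel_condition_def
      dual_matrix_eq_iff matrix_eq)

lemma dual_minus_le_refl: "E \<in> DMPGI_matrices \<Longrightarrow> dual_minus_le E E"
  by (simp add: dual_minus_le_def minus_le_iff rank_eq_0_iff has_DMPGI_std_0_iff)

lemma dual_minus_le_antisym: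
  assumes "dual_minus_le E F" "dual_minus_le F E"
  shows "E = F"
proof -
  have "std_matrix (F - E) = 0"
    using assms minus_le_antisym unfolding dual_minus_le_def by (metis diff_self std_matrix_simps(3))
  then show ?thesis
    using assms has_DMPGI_std_0_iff unfolding dual_minus_le_def by force
qed

lemma dual_minus_le_trans:
  assumes "dual_minus_le E F" "dual_minus_le F G"
  shows "dual_minus_le E G"
proof -
  have "minus_le (std_matrix E) (std_matrix F)" "minus_le (std_matrix F) (std_matrix G)"
    using assms unfolding dual_minus_le_def by blast+
  note std = minus_le_trans_rank[OF this]
  have "has_DMPGI ((F - E) + (G - F))"
    using assms std(2) unfolding dual_minus_le_def by (intro has_DMPGI_add) simp_all
  then show ?thesis
    using assms std(1) unfolding dual_minus_le_def by simp
qed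

theorem theorem3p3:
  "partial_order_on (DMPGI_matrices :: (dual ^ 'n ^ 'm) set) {(E, F). dual_minus_le E F}"
proof -
  have "{(E, F). dual_minus_le E F} \<subseteq> DMPGI_matrices \<times> (DMPGI_matrices :: (dual ^ 'n ^ 'm) set)"
    by (auto simp: dual_minus_le_def)
  then show ?thesis
    unfolding partial_order_on_def preorder_on_def refl_on_def
    using dual_minus_le_refl dual_minus_le_antisym dual_minus_le_trans
    by (intro conjI transI antisymI ballI) blast+
qed

end
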